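(* Let $\mathbf{X}=(\mathbf{x},\mathbf{y})$, $\mathbf{U}=(\mathbf{u},\mathbf{v})$, $\mathbf{S}=(\mathbf{s},\mathbf{r})\in\mathbb{R}^3\times\mathbb{R}^3$. For $i\ge2$ the second directional derivative of $\mathbf{P}_i$ along $\mathbf{U}$ and $\mathbf{S}$ is $$(\mathrm{D}_{\mathbf{X}}^2\mathbf{P}_i)(\mathbf{U})(\mathbf{S})=\sum_{j=1}^{i-1}\Big((\mathrm{D}_{\mathbf{X}}\mathbf{P}_j)(\mathbf{S})\,\mathbf{ad}_{\mathbf{U}}\,\mathbf{P}_{i-j-1}(\mathbf{X})+\mathbf{P}_{i-j-1}(\mathbf{X})\,\mathbf{ad}_{\mathbf{U}}\,(\mathrm{D}_{\mathbf{X}}\mathbf{P}_j)(\mathbf{S})\Big).$$ Moreover, for $\varphi=\|\mathbf{x}\|\ne0$ (and $\beta\ne0$ for the $b_i$), the non-zero second directional derivatives of the coefficients $a_1,\dots,a_4,b_2,b_4$ are $$(\mathrm{D}_{\mathbf{X}}^2a_i)(\mathbf{U})(\mathbf{S})=(\mathbf{s}^T\mathbf{u})\,\bar a_i(\mathbf{x})+(\mathbf{x}^T\mathbf{u})(\mathbf{x}^T\mathbf{s})\,\breve a_i(\mathbf{x})\ (i=1,\dots,4),$$ $$(\mathrm{D}_{\mathbf{X}}^2b_i)(\mathbf{U})(\mathbf{S})=(\mathbf{s}^T\mathbf{u})\,\bar b_i(\mathbf{x})+(\mathbf{x}^T\mathbf{u})(\mathbf{x}^T\mathbf{s})\,\breve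 b_i(\mathbf{x})\ (i=2,4),$$ with $$\breve a_1=\tfrac1{\varphi^2}\left(\tfrac\alpha2-\tfrac74\beta\right)+\tfrac1{\varphi^4}\left(\tfrac72-\tfrac{23}2\alpha+8\beta\right),$$ $$\breve a_2=\tfrac1{\varphi^2}\tfrac14\beta+\tfrac1{\varphi^4}\left(5\alpha-\tfrac{43}4\beta-\tfrac12\right)+\tfrac1{\varphi^6}\left(\tfrac{75}2-\tfrac{75}2\alpha\right),$$ $$\breve a_3=\tfrac1{\varphi^4}\left(\tfrac12\alpha-\tfrac94\beta\right)+\tfrac1{\varphi^6}\left(\tfrac92-\tfrac{33}2\alpha+12\beta\right),$$ $$\breve a_4=\tfrac1{\varphi^4}\tfrac14\beta+\tfrac1{\varphi^6}\left(6\alpha-\tfrac12-\tfrac{57}4\beta\right)+\tfrac1{\varphi^8}\left(\tfrac{105}2-\tfrac{105}2\alpha\right),$$ $$\breve b_2=\tfrac1{\varphi^6}\left(16+\tfrac1{\beta^2}+\left(\tfrac8\beta-\tfrac92\right)\gamma-\left(9+\tfrac4\beta\right)\gamma^2-12\gamma^3+\tfrac9{2\beta}\right)-\tfrac1{\varphi^4}\left(\tfrac94+3\gamma+\tfrac1{2\beta}\right),$$ $$\breve b_4=\tfrac1{\varphi^8}\left(24-\tfrac2\beta-\left(\tfrac{15}2+\tfrac4\beta\right)\gamma-\left(\tfrac{11}2+\tfrac3\beta\right)\gamma^2-2\gamma^3\right)-\tfrac1{\varphi^6}\left(\tfrac{11}8+\tfrac1{4\beta}+\tfrac12\gamma\right),$$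 whose limits for $\mathbf{x}\to\mathbf{0}$ are $\breve a_1(\mathbf{0})=-\frac1{90}$, $\breve a_2(\mathbf{0})=-\frac1{630}$, $\breve a_3(\mathbf{0})=\frac1{1680}$, $\breve a_4(\mathbf{0})=\frac1{15120}$, $\breve b_2(\mathbf{0})=-\frac1{3780}$, $\breve b_4(\mathbf{0})=-\frac1{50400}$.
   Context: For $\mathbf{x}\in\mathbb{R}^3$, $\tilde{\mathbf{x}}$ is the skew-symmetric matrix with $\tilde{\mathbf{x}}\mathbf{w}=\mathbf{x}\times\mathbf{w}$. For $\mathbf{X}=(\mathbf{x},\mathbf{y})\in\mathbb{R}^3\times\mathbb{R}^3\cong se(3)$, $\mathbf{ad}_{\mathbf{X}}=\begin{bmatrix}\tilde{\mathbf{x}}&\mathbf{0}\\ \tilde{\mathbf{y}}&\tilde{\mathbf{x}}\end{bmatrix}$ and $\mathbf{P}_i(\mathbf{X}):=\mathbf{ad}_{\mathbf{X}}^i$ ($\mathbf{P}_0=\mathbf{I}$). For a (scalar or matrix) function $F$ of $\mathbf{X}$: $(\mathrm{D}_{\mathbf{X}}F)(\mathbf{U}):=\frac{d}{dt}F(\mathbf{X}+t\mathbf{U})|_{t=0}$ and $(\mathrm{D}_{\mathbf{X}}^2F)(\mathbf{U})(\mathbf{S}):=\frac{d}{dt}(\mathrm{D}_{\mathbf{X}+t\mathbf{S}}F)(\mathbf{U})|_{t=0}$. Put $\varphi:=\|\mathbf{x}\|$, $\mathrm{sinc}\,t=\sin t/t$, $\alpha:=\mathrm{sinc}\,\varphi$,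 $\beta:=\mathrm{sinc}^2\frac\varphi2$, $\gamma:=\alpha/\beta$, $\delta:=\frac{1-\alpha}{\varphi^2}$. The coefficients are $a_1=\beta-\frac\alpha2$, $a_2=\frac12(5\delta-\frac\beta2)$, $a_3=\frac1{2\varphi^2}(\beta-\alpha)$, $a_4=\frac1{2\varphi^2}(3\delta-\frac\beta2)$; $b_1=-\frac12$, $b_2=\frac1{\varphi^2}(2-\frac{1+3\alpha}{2\beta})$, $b_3=0$, $b_4=\frac1{\varphi^4}(1-\frac{1+\alpha}{2\beta})$; and $\bar a_1=\frac14\beta+\frac1{\varphi^2}(\frac52\alpha-2\beta-\frac12)$, $\bar a_2=\frac1{\varphi^2}(\frac74\beta-\frac12\alpha)+\frac{15}{2\varphi^4}(\alpha-1)$, $\bar a_3=\bar a_1/\varphi^2$, $\bar a_4=\bar a_2/\varphi^2$, $\bar b_2=\frac3{4\varphi^2}+\frac1{\varphi^4}\left(\gamma(\frac32+\frac1\beta+3\gamma)-\frac3{2\beta}-4\right)$, $\bar b_4=\frac1{4\varphi^4}+\frac1{\varphi^6}\left(\frac1{2\beta}+\frac32\gamma+\frac\gamma\beta+\gamma^2-4\right)$. *)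

theory Defs
  imports "HOL-Analysis.Analysis" "HOL-Probability.Sinc_Integral"
begin

definition dir_deriv ::
  "('a::real_normed_vector \<Rightarrow> 'b::real_normed_vector) \<Rightarrow> 'a \<Rightarrow> 'a \<Rightarrow> 'b"
  where "dir_deriv F X U = vector_derivative (\<lambda>t. F (X + t *\<^sub>R U)) (at 0)"

text \<open>\<open>has_dir_deriv2 F X U S D\<close> says that the iterated derivative
  \<open>(D\<^sub>X\<^sup>2 F)(U)(S)\<close> exists and equals \<open>D\<close>.  Since
  \<^const>\<open>vector_derivative\<close> is total, existence of the inner derivative for all
  small \<open>t\<close> is required explicitly.\<close>

definition has_dir_deriv2 ::
  "('a::real_normed_vector \<Rightarrow> 'b::real_normed_vector) \<Rightarrow> 'a \<Rightarrow> 'a \<Rightarrow> 'a \<Rightarrow> 'b \<Rightarrow> bool"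
  where "has_dir_deriv2 F X U S D \<longleftrightarrow>
    (\<forall>\<^sub>F t in nhds 0. (\<lambda>\<tau>. F (X + t *\<^sub>R S + \<tau> *\<^sub>R U)) differentiable (at 0)) \<and>
    ((\<lambda>t. dir_deriv F (X + t *\<^sub>R S) U) has_vector_derivative D) (at 0)"

definition skew :: "real^3 \<Rightarrow> real^3^3"
  where "skew x = matrix (cross3 x)"

lemma skew_mult_vec: "skew x *v w = cross3 x w"
  by (simp add: skew_def matrix_def matrix_vector_mult_def vec_eq_iff forall_3 sum_3
      cross3_def axis_def)

lemma transpose_skew: "transpose (skew x) = - skew x"
  by (simp add: skew_def matrix_def transpose_def vec_eq_iff forall_3 cross3_def axis_def)

text \<open>6x6 matrices are indexed by the sum type \<open>3 + 3\<close>: \<^const>\<open>Inl\<close> is the first and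
  \<^const>\<open>Inr\<close> the second block of rows or columns.\<close>

definition ad :: "(real^3) \<times> (real^3) \<Rightarrow> real^(3+3)^(3+3)"
  where "ad X = (\<chi> i j. case (i, j) of
      (Inl k, Inl l) \<Rightarrow> skew (fst X) $ k $ l
    | (Inl k, Inr l) \<Rightarrow> 0
    | (Inr k, Inl l) \<Rightarrow> skew (snd X) $ k $ l
    | (Inr k, Inr l) \<Rightarrow> skew (fst X) $ k $ l)"

text \<open>The type class operations \<open>*\<close> and \<open>^\<close> on vectors are componentwise, so the matrix
  power is an iterated \<open>**\<close>.\<close>

definition ad_pow :: "nat \<Rightarrow> (real^3) \<times> (real^3) \<Rightarrow> real^(3+3)^(3+3)"
  where "ad_pow i X = (((**) (ad X)) ^^ i) (mat 1)"

lemma linear_ad: "linear ad"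
  by (rule linearI)
    (auto simp: ad_def skew_def matrix_def vec_eq_iff cross3_def axis_def forall_3
      algebra_simps split: sum.splits)

lemma bounded_bilinear_matrix_mult:
  "bounded_bilinear ((**) :: real^'n^'m \<Rightarrow> real^'k^'n \<Rightarrow> real^'k^'m)"
  by (rule bilinear_conv_bounded_bilinear[THEN iffD1])
    (auto simp: bilinear_def matrix_matrix_mult_def vec_eq_iff algebra_simps
      sum.distrib sum_distrib_left intro!: linearI)

text \<open>The first directional derivatives of the powers exist, so \<open>dir_deriv (ad_pow i)\<close>
  is never a junk value.\<close>

lemma ad_pow_differentiable: "(\<lambda>t. ad_pow i (X + t *\<^sub>R U)) differentiable (at (t0::real))"
proof (induction i)
  case 0
  then show ?case by (simp add: ad_pow_def)
next
  case (Suc i)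
  have "(\<lambda>t. ad (X + t *\<^sub>R U)) differentiable (at t0)"
    by (simp add: linear_add[OF linear_ad] linear_cmul[OF linear_ad] differentiable_add
        differentiable_scaleR)
  then obtain D where D: "((\<lambda>t. ad (X + t *\<^sub>R U)) has_derivative D) (at t0)"
    unfolding differentiable_def by blast
  from Suc obtain E where E: "((\<lambda>t. ad_pow i (X + t *\<^sub>R U)) has_derivative E) (at t0)"
    unfolding differentiable_def by blast
  show ?case
    using bounded_bilinear.FDERIV[OF bounded_bilinear_matrix_mult D E]
    unfolding differentiable_def by (auto simp: ad_pow_def)
qed

text \<open>All formulas are taken verbatim as functions of \<open>x\<close> with \<open>\<phi> = norm x\<close>; where a denominator
  vanishes (\<open>x = 0\<close>, or \<open>beta x = 0\<close>) the values are those of the totalised division and carry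
  no meaning.\<close>

definition alpha :: "real^3 \<Rightarrow> real" where "alpha x = sinc (norm x)"
definition beta :: "real^3 \<Rightarrow> real" where "beta x = (sinc (norm x / 2))\<^sup>2"
definition gamma :: "real^3 \<Rightarrow> real" where "gamma x = alpha x / beta x"
definition delta :: "real^3 \<Rightarrow> real" where "delta x = (1 - alpha x) / (norm x)\<^sup>2"

definition a1 :: "real^3 \<Rightarrow> real" where
  "a1 x = beta x - alpha x / 2"
definition a2 :: "real^3 \<Rightarrow> real" where
  "a2 x = 1/2 * (5 * delta x - beta x / 2)"
definition a3 :: "real^3 \<Rightarrow> real" where
  "a3 x = 1 / (2 * (norm x)\<^sup>2) * (beta x - alpha x)"
definition a4 :: "real^3 \<Rightarrow> real" where
  "a4 x = 1 / (2 * (norm x)\<^sup>2) * (3 * delta x - beta x / 2)"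

definition b1 :: "real^3 \<Rightarrow> real" where
  "b1 x = - 1/2"
definition b2 :: "real^3 \<Rightarrow> real" where
  "b2 x = 1 / (norm x)^2 * (2 - (1 + 3 * alpha x) / (2 * beta x))"
definition b3 :: "real^3 \<Rightarrow> real" where
  "b3 x = 0"
definition b4 :: "real^3 \<Rightarrow> real" where
  "b4 x = 1 / (norm x)^4 * (1 - (1 + alpha x) / (2 * beta x))"

definition bar_a1 :: "real^3 \<Rightarrow> real" where
  "bar_a1 x = 1/4 * beta x + 1 / (norm x)^2 * (5/2 * alpha x - 2 * beta x - 1/2)"
definition bar_a2 :: "real^3 \<Rightarrow> real" where
  "bar_a2 x = 1 / (norm x)^2 * (7/4 * beta x - 1/2 * alpha x)
     + 15 / (2 * (norm x)^4) * (alpha x - 1)"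
definition bar_a3 :: "real^3 \<Rightarrow> real" where
  "bar_a3 x = bar_a1 x / (norm x)^2"
definition bar_a4 :: "real^3 \<Rightarrow> real" where
  "bar_a4 x = bar_a2 x / (norm x)^2"
definition bar_b2 :: "real^3 \<Rightarrow> real" where
  "bar_b2 x = 3 / (4 * (norm x)^2)
     + 1 / (norm x)^4 * (gamma x * (3/2 + 1 / beta x + 3 * gamma x) - 3 / (2 * beta x) - 4)"
definition bar_b4 :: "real^3 \<Rightarrow> real" where
  "bar_b4 x = 1 / (4 * (norm x)^4)
     + 1 / (norm x)^6 * (1 / (2 * beta x) + 3/2 * gamma x + gamma x / beta x + (gamma x)^2 - 4)"

definition breve_a1 :: "real^3 \<Rightarrow> real" where
  "breve_a1 x = 1 / (norm x)^2 * (alpha x / 2 - 7/4 * beta x)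
     + 1 / (norm x)^4 * (7/2 - 23/2 * alpha x + 8 * beta x)"
definition breve_a2 :: "real^3 \<Rightarrow> real" where
  "breve_a2 x = 1 / (norm x)^2 * (1/4 * beta x)
     + 1 / (norm x)^4 * (5 * alpha x - 43/4 * beta x - 1/2)
     + 1 / (norm x)^6 * (75/2 - 75/2 * alpha x)"
definition breve_a3 :: "real^3 \<Rightarrow> real" where
  "breve_a3 x = 1 / (norm x)^4 * (1/2 * alpha x - 9/4 * beta x)
     + 1 / (norm x)^6 * (9/2 - 33/2 * alpha x + 12 * beta x)"
definition breve_a4 :: "real^3 \<Rightarrow> real" where
  "breve_a4 x = 1 / (norm x)^4 * (1/4 * beta x)
     + 1 / (norm x)^6 * (6 * alpha x - 1/2 - 57/4 * beta x)
     + 1 / (norm x)^8 * (105/2 - 105/2 * alpha x)"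
definition breve_b2 :: "real^3 \<Rightarrow> real" where
  "breve_b2 x = 1 / (norm x)^6 *
       (16 + 1 / (beta x)^2 + (8 / beta x - 9/2) * gamma x - (9 + 4 / beta x) * (gamma x)^2
        - 12 * (gamma x)^3 + 9 / (2 * beta x))
     - 1 / (norm x)^4 * (9/4 + 3 * gamma x + 1 / (2 * beta x))"
definition breve_b4 :: "real^3 \<Rightarrow> real" where
  "breve_b4 x = 1 / (norm x)^8 *
       (24 - 2 / beta x - (15/2 + 4 / beta x) * gamma x - (11/2 + 3 / beta x) * (gamma x)^2
        - 2 * (gamma x)^3)
     - 1 / (norm x)^6 * (11/8 + 1 / (4 * beta x) + 1/2 * gamma x)"

end

theory Submission
  imports Defs "HOL-Real_Asymp.Real_Asymp"
begin

text \<open>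
  All parts rest on the same principle: if \<open>F\<close> has Frechet derivative \<open>F' Y\<close> at every \<open>Y\<close> near
  \<open>X\<close>, and \<open>Y \<mapsto> F' Y U\<close> has Frechet derivative \<open>G\<close> at \<open>X\<close>, then the iterated directional derivative
  along \<open>U\<close> and \<open>S\<close> is \<open>G S\<close> (\<open>has_dir_deriv2I\<close>).

  For the powers \<open>P\<^sub>i\<close> the Leibniz rule gives \<open>F' X U = (\<Sum>j<i. P\<^sub>j ad\<^sub>U P\<^bsub>i-1-j\<^esub>)\<close>.  Differentiating
  once more hits either the left or the right factor of each summand; reversing the summation in the
  second group of terms pairs \<open>j\<close> with \<open>i - 1 - j\<close> and yields the claimed sum
  (\<open>has_dir_deriv2_ad_pow\<close>).

  The coefficients are radial functions of \<open>x\<close>.  The gradient of a radial function is a radial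
  multiple of \<open>x\<close>; if \<open>\<nabla>F(z) = g(z) z\<close> near \<open>x\<close> and \<open>\<nabla>g(x) = h x\<close>, then the product rule gives
  \<open>(s \<bullet> u) g(x) + (x \<bullet> u) (x \<bullet> s) h\<close> for the second derivative (\<open>has_dir_deriv2_radial\<close>).  It
  therefore suffices to check, for every non-constant coefficient \<open>c\<close>, that \<open>\<nabla>c = bar_c x\<close> and
  \<open>\<nabla>bar_c = breve_c x\<close>.

  With \<open>q = \<phi>\<^sup>2\<close> the functions \<open>\<alpha>\<close> and \<open>\<beta>\<close> satisfy
  \<open>\<nabla>\<alpha> = (1 - q\<beta>/2 - \<alpha>)/q x\<close> and \<open>\<nabla>\<beta> = 2(\<alpha> - \<beta>)/q x\<close>, so the polynomials in \<open>\<alpha>\<close>, \<open>\<beta>\<close>, \<open>1/q\<close> are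
  closed under differentiation and the identities for \<open>a\<^sub>1, \<dots>, a\<^sub>4\<close> are rational identities in which
  \<open>\<alpha>\<close>, \<open>\<beta>\<close> and \<open>\<phi>\<close> may be treated as independent variables.  For the \<open>b\<^sub>i\<close> this is no longer
  so: the form given to \<open>breve_b4\<close> presupposes the Pythagorean relation \<open>\<alpha>\<^sup>2 = \<beta> - q\<beta>\<^sup>2/4\<close>.  Dividing that relation by
  \<open>\<beta>\<^sup>2\<close> turns it into \<open>1/\<beta> = \<gamma>\<^sup>2 + q/4\<close> (\<open>inverse_beta\<close>), which eliminates \<open>\<alpha>\<close> and \<open>\<beta>\<close> in favour of
  \<open>\<gamma> = \<phi>/2 cot(\<phi>/2)\<close>.  As \<open>\<gamma>\<close> satisfies a Riccati equation, \<open>\<nabla>\<gamma> = ((\<gamma> - \<gamma>\<^sup>2)/q - 1/4) x\<close>, the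
  polynomials in \<open>\<gamma>\<close>, \<open>q\<close>, \<open>1/q\<close> are again closed under differentiation, and the identities hold with
  \<open>\<gamma>\<close> and \<open>\<phi>\<close> as independent variables.

  The limits at the origin are one-dimensional limits \<open>\<phi> \<rightarrow> 0+\<close> of expressions in \<open>sin \<phi>\<close>,
  \<open>cos \<phi>\<close> and \<open>\<phi>\<close>, settled by Taylor expansion.
\<close>

section \<open>Iterated directional derivatives from Frechet derivatives\<close>

lemma dir_deriv_eq:
  assumes "(F has_derivative F') (at X)"
  shows "dir_deriv F X U = F' U"
proof -
  have "((\<lambda>t. X + t *\<^sub>R U) has_derivative (\<lambda>t. t *\<^sub>R U)) (at 0)"
    by (auto intro!: derivative_eq_intros)
  with assms have "((\<lambda>t. F (X + t *\<^sub>R U)) has_derivative (\<lambda>t. F' (t *\<^sub>R U))) (at 0)"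
    using has_derivative_compose[of "\<lambda>t. X + t *\<^sub>R U" _ 0 UNIV F F'] by simp
  then have "((\<lambda>t. F (X + t *\<^sub>R U)) has_vector_derivative F' U) (at 0)"
    using has_derivative_linear[OF assms]
    by (simp add: has_vector_derivative_def linear_cmul)
  then show ?thesis
    by (simp add: dir_deriv_def vector_derivative_at)
qed

text \<open>The first derivative is assumed near \<open>X\<close> and not only at \<open>X\<close>, since the inner derivative is taken
  at the points \<open>X + t S\<close>, where it must both exist and agree with \<open>F'\<close>.\<close>

lemma has_dir_deriv2I:
  assumes F: "\<forall>\<^sub>F Y in nhds X. (F has_derivative F' Y) (at Y)"
    and G: "((\<lambda>Y. F' Y U) has_derivative G) (at X)"
  shows "has_dir_deriv2 F X U S (G S)"
proof -
  have line: "((\<lambda>t. Z + t *\<^sub>R V) has_derivative (\<lambda>t. t *\<^sub>R V)) (at 0)" for Z V :: 'a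
    by (auto intro!: derivative_eq_intros)
  have "filterlim (\<lambda>t. X + t *\<^sub>R S) (nhds X) (nhds 0)"
    by (rule tendsto_eq_intros refl filterlim_ident | simp)+
  with F have ev: "\<forall>\<^sub>F t in nhds 0.
      (F has_derivative F' (X + t *\<^sub>R S)) (at (X + t *\<^sub>R S))"
    by (rule eventually_compose_filterlim)
  have "\<forall>\<^sub>F t in nhds 0. (\<lambda>\<tau>. F (X + t *\<^sub>R S + \<tau> *\<^sub>R U)) differentiable (at 0)"
    using ev
  proof eventually_elim
    case (elim t)
    then show ?case
      using has_derivative_compose[OF line[of "X + t *\<^sub>R S" U], of F]
      by (auto simp: differentiable_def)
  qed
  moreover
  have "((\<lambda>t. F' (X + t *\<^sub>R S) U) has_derivative (\<lambda>t. G (t *\<^sub>R S))) (at 0)"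
    using has_derivative_compose[OF line[of X S], of "\<lambda>Y. F' Y U" G] G by simp
  then have "((\<lambda>t. F' (X + t *\<^sub>R S) U) has_vector_derivative G S) (at 0)"
    using has_derivative_linear[OF G]
    by (simp add: has_vector_derivative_def linear_cmul)
  moreover have "\<forall>\<^sub>F t in nhds 0. dir_deriv F (X + t *\<^sub>R S) U = F' (X + t *\<^sub>R S) U"
    using ev by eventually_elim (rule dir_deriv_eq)
  ultimately show ?thesis
    unfolding has_dir_deriv2_def
    by (subst has_vector_derivative_cong_ev[where g = "\<lambda>t. F' (X + t *\<^sub>R S) U"])
      (auto dest: eventually_nhds_x_imp_x elim: eventually_mono)
qed

lemma has_dir_deriv2_const: "has_dir_deriv2 (\<lambda>_. c) X U S 0"
  by (rule has_dir_deriv2I[where F' = "\<lambda>_ _. 0" and G = "\<lambda>_. 0"]) simp_all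

section \<open>Powers of the adjoint matrix\<close>

lemma has_derivative_ad_pow:
  "(ad_pow i has_derivative
     (\<lambda>U. \<Sum>j<i. ad_pow j X ** ad U ** ad_pow (i - 1 - j) X)) (at X)"
proof (induction i)
  case 0
  then show ?case by (simp add: ad_pow_def)
next
  case (Suc i)
  have ad_Suc: "ad_pow (Suc k) Y = ad Y ** ad_pow k Y" for k Y
    by (simp add: ad_pow_def)
  have "(ad has_derivative ad) (at X)"
    using linear_ad by (simp add: linear_imp_has_derivative)
  from bounded_bilinear.FDERIV[OF bounded_bilinear_matrix_mult this Suc]
  have "(ad_pow (Suc i) has_derivative
      (\<lambda>U. ad X ** (\<Sum>j<i. ad_pow j X ** ad U ** ad_pow (i - 1 - j) X) + ad U ** ad_pow i X))
      (at X)"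
    by (simp add: ad_Suc[abs_def])
  also have "(\<lambda>U. ad X ** (\<Sum>j<i. ad_pow j X ** ad U ** ad_pow (i - 1 - j) X) + ad U ** ad_pow i X)
    = (\<lambda>U. \<Sum>j<Suc i. ad_pow j X ** ad U ** ad_pow (Suc i - 1 - j) X)"
  proof
    fix U
    have "(\<Sum>j<Suc i. ad_pow j X ** ad U ** ad_pow (Suc i - 1 - j) X)
        = ad U ** ad_pow i X
          + (\<Sum>j<i. ad_pow (Suc j) X ** ad U ** ad_pow (Suc i - 1 - Suc j) X)"
      by (subst sum.lessThan_Suc_shift) (simp add: ad_pow_def)
    also have "(\<Sum>j<i. ad_pow (Suc j) X ** ad U ** ad_pow (Suc i - 1 - Suc j) X)
        = ad X ** (\<Sum>j<i. ad_pow j X ** ad U ** ad_pow (i - 1 - j) X)"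
      by (subst bounded_bilinear.sum_right[OF bounded_bilinear_matrix_mult])
        (simp add: ad_Suc matrix_mul_assoc)
    finally show "ad X ** (\<Sum>j<i. ad_pow j X ** ad U ** ad_pow (i - 1 - j) X) + ad U ** ad_pow i X
        = (\<Sum>j<Suc i. ad_pow j X ** ad U ** ad_pow (Suc i - 1 - j) X)"
      by (simp add: add.commute)
  qed
  finally show ?case .
qed

text \<open>The stated sum starts at \<open>j = 1\<close> because the summand with index \<open>0\<close> contains the derivative
  of the constant \<open>P\<^sub>0\<close>.\<close>

lemma has_dir_deriv2_ad_pow:
  assumes "i \<ge> 1"
  shows "has_dir_deriv2 (ad_pow i) X U S
    (\<Sum>j = 1..i - 1.
        dir_deriv (ad_pow j) X S ** ad U ** ad_pow (i - j - 1) X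
      + ad_pow (i - j - 1) X ** ad U ** dir_deriv (ad_pow j) X S)"
proof -
  define dP where "dP j = dir_deriv (ad_pow j) X" for j
  have dP_deriv: "(ad_pow j has_derivative dP j) (at X)" for j
    using has_derivative_ad_pow[of j X] unfolding dP_def
    by (rule has_derivative_eq_rhs) (simp add: fun_eq_iff dir_deriv_eq[OF has_derivative_ad_pow])
  have [simp]: "dP 0 = (\<lambda>_. 0)"
    using dir_deriv_eq[OF has_derivative_ad_pow[of 0 X]] by (simp add: dP_def fun_eq_iff)
  define G where "G V = (\<Sum>j<i. ad_pow j X ** ad U ** dP (i - 1 - j) V
      + dP j V ** ad U ** ad_pow (i - 1 - j) X)" for V
  have mult: "((\<lambda>Y. A Y ** B Y) has_derivative (\<lambda>V. A X ** B' V + A' V ** B X)) (at X)"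
    if "(A has_derivative A') (at X)" "(B has_derivative B') (at X)"
    for A B :: "(real^3) \<times> (real^3) \<Rightarrow> real^(3+3)^(3+3)" and A' B'
    using bounded_bilinear.FDERIV[OF bounded_bilinear_matrix_mult that] .
  have "((\<lambda>Y. ad_pow j Y ** ad U ** ad_pow (i - 1 - j) Y) has_derivative
      (\<lambda>V. ad_pow j X ** ad U ** dP (i - 1 - j) V
          + dP j V ** ad U ** ad_pow (i - 1 - j) X)) (at X)" for j
    using mult[OF mult[OF dP_deriv[of j] has_derivative_const[of "ad U"]]
        dP_deriv[of "i - 1 - j"]] by simp
  then have "((\<lambda>Y. \<Sum>j<i. ad_pow j Y ** ad U ** ad_pow (i - 1 - j) Y) has_derivative G) (at X)"
    unfolding G_def by (intro has_derivative_sum)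
  then have "has_dir_deriv2 (ad_pow i) X U S (G S)"
    by (intro has_dir_deriv2I[where F' = "\<lambda>Y V. \<Sum>j<i. ad_pow j Y ** ad V ** ad_pow (i - 1 - j) Y"]
        always_eventually allI has_derivative_ad_pow)
  also have "G S = (\<Sum>j<i. dP j S ** ad U ** ad_pow (i - 1 - j) X)
      + (\<Sum>j<i. ad_pow j X ** ad U ** dP (i - 1 - j) S)"
    by (simp add: G_def sum.distrib add.commute)
  \<comment> \<open>Reversing the order of summation puts the differentiated power at index \<open>j\<close> here, too.\<close>
  also have "(\<Sum>j<i. ad_pow j X ** ad U ** dP (i - 1 - j) S)
      = (\<Sum>j<i. ad_pow (i - 1 - j) X ** ad U ** dP j S)"
    by (rule sum.reindex_bij_witness[of _ "\<lambda>j. i - 1 - j" "\<lambda>j. i - 1 - j"]) auto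
  also have "(\<Sum>j<i. dP j S ** ad U ** ad_pow (i - 1 - j) X)
      + (\<Sum>j<i. ad_pow (i - 1 - j) X ** ad U ** dP j S)
    = (\<Sum>j<i. dP j S ** ad U ** ad_pow (i - j - 1) X + ad_pow (i - j - 1) X ** ad U ** dP j S)"
    by (simp add: sum.distrib diff_right_commute)
  also have "\<dots> = (\<Sum>j = 1..i - 1.
      dP j S ** ad U ** ad_pow (i - j - 1) X + ad_pow (i - j - 1) X ** ad U ** dP j S)"
    by (rule sum.mono_neutral_right) (use assms in \<open>auto simp: Suc_le_eq\<close>)
  finally show ?thesis
    by (simp add: dP_def)
qed

section \<open>Radial functions\<close>

text \<open>Differentiating \<open>g(z) (z \<bullet> u)\<close> along \<open>s\<close> gives one term from the linear factor and one from
  the radial factor \<open>g\<close>.\<close>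

lemma has_dir_deriv2_radial:
  fixes F :: "'a::real_inner \<Rightarrow> real" and X U S :: "'a \<times> 'b::real_normed_vector"
  assumes F: "\<forall>\<^sub>F z in nhds (fst X). (F has_derivative (\<lambda>w. g z * (z \<bullet> w))) (at z)"
    and g: "(g has_derivative (\<lambda>w. h * (fst X \<bullet> w))) (at (fst X))"
  shows "has_dir_deriv2 (\<lambda>Y. F (fst Y)) X U S
    ((fst S \<bullet> fst U) * g (fst X) + (fst X \<bullet> fst U) * (fst X \<bullet> fst S) * h)"
proof -
  have fst: "(fst has_derivative fst) (at Y)" for Y :: "'a \<times> 'b"
    by (auto intro!: derivative_eq_intros)
  have "filterlim fst (nhds (fst X)) (nhds X)"
    by (rule tendsto_fst[OF filterlim_ident])
  then have "\<forall>\<^sub>F Y in nhds X. (F has_derivative (\<lambda>w. g (fst Y) * (fst Y \<bullet> w))) (at (fst Y))"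
    by (rule eventually_compose_filterlim[OF F])
  then have "\<forall>\<^sub>F Y in nhds X.
      ((\<lambda>Y. F (fst Y)) has_derivative (\<lambda>V. g (fst Y) * (fst Y \<bullet> fst V))) (at Y)"
    by eventually_elim (rule has_derivative_compose[OF fst])
  moreover have "((\<lambda>Y. g (fst Y) * (fst Y \<bullet> fst U)) has_derivative
      (\<lambda>V. (fst V \<bullet> fst U) * g (fst X) + (fst X \<bullet> fst U) * (fst X \<bullet> fst V) * h)) (at X)"
    by (rule derivative_eq_intros has_derivative_compose[OF fst g] refl)+
      (auto simp: fun_eq_iff algebra_simps)
  ultimately show ?thesis
    by (rule has_dir_deriv2I)
qed

text \<open>The derivative of the profile is written as \<open>\<phi> c\<close> because the gradient of the norm
  contributes \<open>x / \<phi>\<close>.\<close>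

lemma radial_chain:
  fixes x :: "'a::real_inner"
  assumes "x \<noteq> 0" and "(f has_real_derivative norm x * c) (at (norm x))"
  shows "((\<lambda>z. f (norm z)) has_derivative (\<lambda>w. c * (x \<bullet> w))) (at x)"
proof -
  have "((\<lambda>z. f (norm z)) has_derivative (\<lambda>w. norm x * c * (sgn x \<bullet> w))) (at x)"
    using has_derivative_compose[OF has_derivative_norm[OF assms(1)], of f "(*) (norm x * c)"] assms(2)
    by (simp add: has_field_derivative_def inner_commute)
  then show ?thesis
    by (rule has_derivative_eq_rhs) (use assms(1) in \<open>simp add: fun_eq_iff sgn_div_norm\<close>)
qed

lemma norm_grad: "x \<noteq> 0 \<Longrightarrow> (norm has_derivative (\<lambda>w. (x \<bullet> w) / norm x)) (at x)"
  for x :: "'a::real_inner"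
  by (rule has_derivative_eq_rhs[OF has_derivative_norm])
    (simp_all add: fun_eq_iff sgn_div_norm inner_commute divide_inverse_commute)

lemma tendsto_radial:
  fixes F :: "'a::real_normed_vector \<Rightarrow> 'b::topological_space"
  assumes "\<And>x. x \<noteq> 0 \<Longrightarrow> F x = f (norm x)" and "(f \<longlongrightarrow> L) (at_right 0)"
  shows "(F \<longlongrightarrow> L) (at 0)"
proof -
  have "filterlim norm (at_right 0) (at (0::'a))"
    unfolding filterlim_at by (auto intro!: tendsto_eq_intros simp: eventually_at_filter)
  with assms(2) have "((\<lambda>x. f (norm x)) \<longlongrightarrow> L) (at (0::'a))"
    by (rule filterlim_compose)
  then show ?thesis
    by (rule Lim_transform_eventually) (auto simp: eventually_at_filter assms(1))
qed

section \<open>Gradients of alpha, beta and gamma\<close>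

lemma beta_eq: "x \<noteq> 0 \<Longrightarrow> beta x = 2 * (1 - cos (norm x)) / (norm x)\<^sup>2"
  using cos_double_sin[of "norm x / 2"] by (simp add: beta_def field_simps power2_eq_square)

lemma alpha_grad:
  assumes "x \<noteq> 0"
  shows "(alpha has_derivative
    (\<lambda>w. (1 - (norm x)\<^sup>2 * beta x / 2 - alpha x) / (norm x)\<^sup>2 * (x \<bullet> w))) (at x)"
proof -
  define p where "p = norm x"
  have p: "p > 0" using assms by (simp add: p_def)
  have "((\<lambda>p. sin p / p) has_real_derivative
     p * ((1 - p\<^sup>2 * beta x / 2 - alpha x) / p\<^sup>2)) (at p)"
    using p by (auto intro!: derivative_eq_intros simp: alpha_def beta_eq[OF assms] p_def[symmetric]
        field_simps power2_eq_square)
  then have "((\<lambda>z. sin (norm z) / norm z) has_derivative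
      (\<lambda>w. (1 - (norm x)\<^sup>2 * beta x / 2 - alpha x) / (norm x)\<^sup>2 * (x \<bullet> w))) (at x)"
    unfolding p_def by (rule radial_chain[OF assms])
  then show ?thesis
    by (rule has_derivative_transform_within_open[where s = "- {0}"])
      (use assms in \<open>auto simp: alpha_def\<close>)
qed

lemma beta_grad:
  assumes "x \<noteq> 0"
  shows "(beta has_derivative (\<lambda>w. 2 * (alpha x - beta x) / (norm x)\<^sup>2 * (x \<bullet> w))) (at x)"
proof -
  define p where "p = norm x"
  have p: "p > 0" using assms by (simp add: p_def)
  have "((\<lambda>p. 2 * (1 - cos p) / p\<^sup>2) has_real_derivative
     p * (2 * (alpha x - beta x) / p\<^sup>2)) (at p)"
    using p by (auto intro!: derivative_eq_intros simp: alpha_def beta_eq[OF assms] p_def[symmetric]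
        field_simps power2_eq_square)
  then have "((\<lambda>z. 2 * (1 - cos (norm z)) / (norm z)\<^sup>2) has_derivative
      (\<lambda>w. 2 * (alpha x - beta x) / (norm x)\<^sup>2 * (x \<bullet> w))) (at x)"
    unfolding p_def by (rule radial_chain[OF assms])
  then show ?thesis
    by (rule has_derivative_transform_within_open[where s = "- {0}"])
      (use assms in \<open>auto simp: beta_eq\<close>)
qed

text \<open>This is \<open>sin\<^sup>2 \<phi> + cos\<^sup>2 \<phi> = 1\<close>, written with \<open>sin \<phi> = \<phi>\<alpha>\<close> and \<open>cos \<phi> = 1 - \<phi>\<^sup>2\<beta>/2\<close>.\<close>

lemma alpha_sq:
  assumes "x \<noteq> 0"
  shows "(alpha x)\<^sup>2 = beta x - (norm x)\<^sup>2 * (beta x)\<^sup>2 / 4"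
proof -
  have "norm x * alpha x = sin (norm x)"
    using assms by (simp add: alpha_def)
  moreover have "cos (norm x) = 1 - (norm x)\<^sup>2 * beta x / 2"
    using assms by (simp add: beta_eq field_simps)
  ultimately have "(norm x * alpha x)\<^sup>2 + (1 - (norm x)\<^sup>2 * beta x / 2)\<^sup>2 = 1"
    using sin_cos_squared_add by metis
  then have "(norm x)\<^sup>2 * (alpha x)\<^sup>2 = (norm x)\<^sup>2 * (beta x - (norm x)\<^sup>2 * (beta x)\<^sup>2 / 4)"
    by (simp add: power2_eq_square algebra_simps)
  with assms show ?thesis by simp
qed

text \<open>The points \<open>x\<close> whose norm is not an integer multiple of \<open>2\<pi>\<close>.\<close>

definition b_domain :: "(real^3) set"
  where "b_domain = {x. x \<noteq> 0 \<and> beta x \<noteq> 0}"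

lemma open_b_domain: "open b_domain"
proof -
  have "continuous_on (- {0}) beta"
    by (auto intro!: continuous_at_imp_continuous_on has_derivative_continuous beta_grad)
  then have "open (beta -` (- {0}) \<inter> - {0})"
    by (subst (asm) continuous_on_open_vimage) auto
  also have "beta -` (- {0}) \<inter> - {0} = b_domain"
    by (auto simp: b_domain_def)
  finally show ?thesis .
qed

lemma inverse_beta:
  assumes "x \<in> b_domain"
  shows "1 / beta x = (gamma x)\<^sup>2 + (norm x)\<^sup>2 / 4"
  using assms alpha_sq[of x]
  by (simp add: b_domain_def gamma_def power_divide field_simps power2_eq_square)

text \<open>The quotient rule produces \<open>1/\<beta>\<close>; replacing it by \<open>\<gamma>\<^sup>2 + \<phi>\<^sup>2/4\<close> makes the equation for \<open>\<gamma>\<close>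
  self-contained.\<close>

lemma gamma_grad:
  assumes "x \<in> b_domain"
  shows "(gamma has_derivative
     (\<lambda>w. ((gamma x - (gamma x)\<^sup>2) / (norm x)\<^sup>2 - 1/4) * (x \<bullet> w))) (at x)"
proof -
  have x: "x \<noteq> 0" "beta x \<noteq> 0"
    using assms by (auto simp: b_domain_def)
  have "(gamma has_derivative
     (\<lambda>w. ((1 / beta x + gamma x - 2 * (gamma x)\<^sup>2) / (norm x)\<^sup>2 - 1/2) * (x \<bullet> w))) (at x)"
    unfolding gamma_def[abs_def]
    by (rule derivative_eq_intros alpha_grad beta_grad x refl)+
      (use x in \<open>simp add: fun_eq_iff field_simps power2_eq_square\<close>)
  then show ?thesis
    by (rule has_derivative_eq_rhs)
      (use x in \<open>simp add: inverse_beta[OF assms] fun_eq_iff field_simps power2_eq_square\<close>)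
qed

section \<open>Gradients of the coefficients\<close>

lemma a1_grad:
  assumes "x \<noteq> 0"
  shows "(a1 has_derivative (\<lambda>w. bar_a1 x * (x \<bullet> w))) (at x)"
  unfolding a1_def[abs_def] bar_a1_def
  by (rule derivative_eq_intros alpha_grad beta_grad norm_grad assms refl
      | (use assms in \<open>simp; fail\<close>))+
    (use assms in \<open>simp add: fun_eq_iff field_simps\<close>)

lemma bar_a1_grad:
  assumes "x \<noteq> 0"
  shows "(bar_a1 has_derivative (\<lambda>w. breve_a1 x * (x \<bullet> w))) (at x)"
  unfolding bar_a1_def[abs_def] breve_a1_def
  by (rule derivative_eq_intros alpha_grad beta_grad norm_grad assms refl
      | (use assms in \<open>simp; fail\<close>))+
    (use assms in \<open>simp_all add: fun_eq_iff field_simps eval_nat_numeral\<close>)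

lemma a2_grad:
  assumes "x \<noteq> 0"
  shows "(a2 has_derivative (\<lambda>w. bar_a2 x * (x \<bullet> w))) (at x)"
  unfolding a2_def[abs_def] bar_a2_def delta_def
  by (rule derivative_eq_intros alpha_grad beta_grad norm_grad assms refl
      | (use assms in \<open>simp; fail\<close>))+
    (use assms in \<open>simp_all add: fun_eq_iff field_simps eval_nat_numeral\<close>)

lemma bar_a2_grad:
  assumes "x \<noteq> 0"
  shows "(bar_a2 has_derivative (\<lambda>w. breve_a2 x * (x \<bullet> w))) (at x)"
  unfolding bar_a2_def[abs_def] breve_a2_def
  by (rule derivative_eq_intros alpha_grad beta_grad norm_grad assms refl
      | (use assms in \<open>simp; fail\<close>))+
    (use assms in \<open>simp_all add: fun_eq_iff field_simps eval_nat_numeral\<close>)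

lemma a3_grad:
  assumes "x \<noteq> 0"
  shows "(a3 has_derivative (\<lambda>w. bar_a3 x * (x \<bullet> w))) (at x)"
  unfolding a3_def[abs_def] bar_a3_def bar_a1_def
  by (rule derivative_eq_intros alpha_grad beta_grad norm_grad assms refl
      | (use assms in \<open>simp; fail\<close>))+
    (use assms in \<open>simp_all add: fun_eq_iff field_simps eval_nat_numeral\<close>)

lemma bar_a3_grad:
  assumes "x \<noteq> 0"
  shows "(bar_a3 has_derivative (\<lambda>w. breve_a3 x * (x \<bullet> w))) (at x)"
  unfolding bar_a3_def[abs_def] breve_a3_def
  by (rule derivative_eq_intros bar_a1_grad norm_grad assms refl
      | (use assms in \<open>simp; fail\<close>))+
    (use assms in \<open>simp_all add: bar_a1_def breve_a1_def fun_eq_iff field_simps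
          eval_nat_numeral\<close>)

lemma a4_grad:
  assumes "x \<noteq> 0"
  shows "(a4 has_derivative (\<lambda>w. bar_a4 x * (x \<bullet> w))) (at x)"
  unfolding a4_def[abs_def] bar_a4_def bar_a2_def delta_def
  by (rule derivative_eq_intros alpha_grad beta_grad norm_grad assms refl
      | (use assms in \<open>simp; fail\<close>))+
    (use assms in \<open>simp_all add: fun_eq_iff field_simps eval_nat_numeral\<close>)

lemma bar_a4_grad:
  assumes "x \<noteq> 0"
  shows "(bar_a4 has_derivative (\<lambda>w. breve_a4 x * (x \<bullet> w))) (at x)"
  unfolding bar_a4_def[abs_def] breve_a4_def
  by (rule derivative_eq_intros bar_a2_grad norm_grad assms refl
      | (use assms in \<open>simp; fail\<close>))+
    (use assms in \<open>simp_all add: bar_a2_def breve_a2_def fun_eq_iff field_simps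
          eval_nat_numeral\<close>)

text \<open>Eliminating \<open>\<alpha>\<close> and \<open>\<beta>\<close>: the right-hand sides are polynomials in \<open>\<gamma>\<close> and \<open>\<phi>\<^sup>2\<close> over a power of
  \<open>\<phi>\<close>, with \<open>\<gamma>\<^sup>2 + \<phi>\<^sup>2/4\<close> in the place of \<open>1/\<beta>\<close>.\<close>

lemma b_in_gamma:
  assumes "x \<in> b_domain"
  shows "b2 x = (2 - ((gamma x)\<^sup>2 + (norm x)\<^sup>2 / 4 + 3 * gamma x) / 2) / (norm x)\<^sup>2"
    and "b4 x = (1 - ((gamma x)\<^sup>2 + (norm x)\<^sup>2 / 4 + gamma x) / 2) / (norm x)^4"
    and "bar_b2 x = (gamma x * (3/2 + ((gamma x)\<^sup>2 + (norm x)\<^sup>2 / 4) + 3 * gamma x)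
          - 3/2 * ((gamma x)\<^sup>2 + (norm x)\<^sup>2 / 4) - 4 + 3/4 * (norm x)\<^sup>2) / (norm x)^4"
    and "bar_b4 x = ((1/2 + gamma x) * ((gamma x)\<^sup>2 + (norm x)\<^sup>2 / 4)
          + 3/2 * gamma x + (gamma x)\<^sup>2 - 4 + (norm x)\<^sup>2 / 4) / (norm x)^6"
  using assms
  by (simp_all add: b2_def b4_def bar_b2_def bar_b4_def inverse_beta[symmetric])
    (simp_all add: b_domain_def gamma_def field_simps eval_nat_numeral)

text \<open>The abbreviation \<open>k\<close> stands where the original formulas have \<open>1/\<beta>\<close>.\<close>

lemma breve_b_in_gamma:
  assumes "x \<in> b_domain"
  defines "k \<equiv> (gamma x)\<^sup>2 + (norm x)\<^sup>2 / 4"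
  shows "breve_b2 x = (16 + k\<^sup>2 + (8 * k - 9/2) * gamma x - (9 + 4 * k) * (gamma x)\<^sup>2
      - 12 * (gamma x)^3 + 9/2 * k - (norm x)\<^sup>2 * (9/4 + 3 * gamma x + k / 2)) / (norm x)^6"
    and "breve_b4 x = (24 - 2 * k - (15/2 + 4 * k) * gamma x - (11/2 + 3 * k) * (gamma x)\<^sup>2
      - 2 * (gamma x)^3 - (norm x)\<^sup>2 * (11/8 + k / 4 + gamma x / 2)) / (norm x)^8"
  unfolding k_def inverse_beta[OF assms(1), symmetric] breve_b2_def breve_b4_def
  using assms(1)
  by (simp_all add: b_domain_def gamma_def field_simps eval_nat_numeral)

lemma b2_grad:
  assumes "x \<in> b_domain"
  shows "(b2 has_derivative (\<lambda>w. bar_b2 x * (x \<bullet> w))) (at x)"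
proof -
  have "x \<noteq> 0" using assms by (simp add: b_domain_def)
  have "((\<lambda>x. (2 - ((gamma x)\<^sup>2 + (norm x)\<^sup>2 / 4 + 3 * gamma x) / 2) / (norm x)\<^sup>2)
     has_derivative (\<lambda>w. bar_b2 x * (x \<bullet> w))) (at x)"
    unfolding b_in_gamma[OF assms]
    by (rule derivative_eq_intros gamma_grad norm_grad assms refl
        | (use \<open>x \<noteq> 0\<close> in \<open>simp; fail\<close>))+
      (use \<open>x \<noteq> 0\<close> in \<open>simp_all add: fun_eq_iff field_simps eval_nat_numeral\<close>)
  then show ?thesis
    by (rule has_derivative_transform_within_open[OF _ open_b_domain assms]) (simp add: b_in_gamma)
qed

lemma b4_grad:
  assumes "x \<in> b_domain"
  shows "(b4 has_derivative (\<lambda>w. bar_b4 x * (x \<bullet> w))) (at x)"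
proof -
  have "x \<noteq> 0" using assms by (simp add: b_domain_def)
  have "((\<lambda>x. (1 - ((gamma x)\<^sup>2 + (norm x)\<^sup>2 / 4 + gamma x) / 2) / (norm x)^4)
     has_derivative (\<lambda>w. bar_b4 x * (x \<bullet> w))) (at x)"
    unfolding b_in_gamma[OF assms]
    by (rule derivative_eq_intros gamma_grad norm_grad assms refl
        | (use \<open>x \<noteq> 0\<close> in \<open>simp; fail\<close>))+
      (use \<open>x \<noteq> 0\<close> in \<open>simp_all add: fun_eq_iff field_simps eval_nat_numeral\<close>)
  then show ?thesis
    by (rule has_derivative_transform_within_open[OF _ open_b_domain assms]) (simp add: b_in_gamma)
qed

lemma bar_b2_grad:
  assumes "x \<in> b_domain"
  shows "(bar_b2 has_derivative (\<lambda>w. breve_b2 x * (x \<bullet> w))) (at x)"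
proof -
  have "x \<noteq> 0" using assms by (simp add: b_domain_def)
  have "((\<lambda>x. (gamma x * (3/2 + ((gamma x)\<^sup>2 + (norm x)\<^sup>2 / 4) + 3 * gamma x)
          - 3/2 * ((gamma x)\<^sup>2 + (norm x)\<^sup>2 / 4) - 4 + 3/4 * (norm x)\<^sup>2) / (norm x)^4)
     has_derivative (\<lambda>w. breve_b2 x * (x \<bullet> w))) (at x)"
    unfolding breve_b_in_gamma[OF assms]
    by (rule derivative_eq_intros gamma_grad norm_grad assms refl
        | (use \<open>x \<noteq> 0\<close> in \<open>simp; fail\<close>))+
      (use \<open>x \<noteq> 0\<close> in \<open>simp_all add: fun_eq_iff field_simps eval_nat_numeral\<close>)
  then show ?thesis
    by (rule has_derivative_transform_within_open[OF _ open_b_domain assms]) (simp add: b_in_gamma)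
qed

lemma bar_b4_grad:
  assumes "x \<in> b_domain"
  shows "(bar_b4 has_derivative (\<lambda>w. breve_b4 x * (x \<bullet> w))) (at x)"
proof -
  have "x \<noteq> 0" using assms by (simp add: b_domain_def)
  have "((\<lambda>x. ((1/2 + gamma x) * ((gamma x)\<^sup>2 + (norm x)\<^sup>2 / 4)
          + 3/2 * gamma x + (gamma x)\<^sup>2 - 4 + (norm x)\<^sup>2 / 4) / (norm x)^6)
     has_derivative (\<lambda>w. breve_b4 x * (x \<bullet> w))) (at x)"
    unfolding breve_b_in_gamma[OF assms]
    by (rule derivative_eq_intros gamma_grad norm_grad assms refl
        | (use \<open>x \<noteq> 0\<close> in \<open>simp; fail\<close>))+
      (use \<open>x \<noteq> 0\<close> in \<open>simp_all add: fun_eq_iff field_simps eval_nat_numeral\<close>)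
  then show ?thesis
    by (rule has_derivative_transform_within_open[OF _ open_b_domain assms]) (simp add: b_in_gamma)
qed

section \<open>Limits at the origin\<close>

text \<open>\<open>\<beta>\<close> is used in the form \<open>2 (1 - cos \<phi>) / \<phi>\<^sup>2\<close>, so that the profiles involve \<open>sin\<close> and \<open>cos\<close>
  at the single argument \<open>\<phi>\<close>.\<close>

lemma breve_tendsto:
  shows "(breve_a1 \<longlongrightarrow> - 1/90) (at 0)"
    and "(breve_a2 \<longlongrightarrow> - 1/630) (at 0)"
    and "(breve_a3 \<longlongrightarrow> 1/1680) (at 0)"
    and "(breve_a4 \<longlongrightarrow> 1/15120) (at 0)"
    and "(breve_b2 \<longlongrightarrow> - 1/3780) (at 0)"
    and "(breve_b4 \<longlongrightarrow> - 1/50400) (at 0)"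
proof -
  define a b g :: "real \<Rightarrow> real"
    where "a p = sin p / p" and "b p = 2 * (1 - cos p) / p\<^sup>2" and "g p = a p / b p" for p
  note profile = a_def b_def g_def
  have coords: "alpha x = a (norm x)" "beta x = b (norm x)" "gamma x = g (norm x)" if "x \<noteq> 0" for x
    using that by (simp_all add: profile alpha_def beta_eq gamma_def)
  have "((\<lambda>p. 1 / p^2 * (a p / 2 - 7/4 * b p) + 1 / p^4 * (7/2 - 23/2 * a p + 8 * b p))
      \<longlongrightarrow> - 1/90) (at_right 0)"
    unfolding profile by real_asymp
  then show "(breve_a1 \<longlongrightarrow> - 1/90) (at 0)"
    by (rule tendsto_radial[rotated]) (simp add: breve_a1_def coords)
  have "((\<lambda>p. 1 / p^2 * (1/4 * b p) + 1 / p^4 * (5 * a p - 43/4 * b p - 1/2) + 1 / p^6 * (75/2 -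
        75/2 * a p))
      \<longlongrightarrow> - 1/630) (at_right 0)"
    unfolding profile by real_asymp
  then show "(breve_a2 \<longlongrightarrow> - 1/630) (at 0)"
    by (rule tendsto_radial[rotated]) (simp add: breve_a2_def coords)
  have "((\<lambda>p. 1 / p^4 * (1/2 * a p - 9/4 * b p) + 1 / p^6 * (9/2 - 33/2 * a p + 12 * b p))
      \<longlongrightarrow> 1/1680) (at_right 0)"
    unfolding profile by real_asymp
  then show "(breve_a3 \<longlongrightarrow> 1/1680) (at 0)"
    by (rule tendsto_radial[rotated]) (simp add: breve_a3_def coords)
  have "((\<lambda>p. 1 / p^4 * (1/4 * b p) + 1 / p^6 * (6 * a p - 1/2 - 57/4 * b p) + 1 / p^8 * (105/2 -
        105/2 * a p))
      \<longlongrightarrow> 1/15120) (at_right 0)"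
    unfolding profile by real_asymp
  then show "(breve_a4 \<longlongrightarrow> 1/15120) (at 0)"
    by (rule tendsto_radial[rotated]) (simp add: breve_a4_def coords)
  have "((\<lambda>p. 1 / p^6 * (16 + 1 / (b p)^2 + (8 / b p - 9/2) * g p - (9 + 4 / b p) * (g p)^2 - 12 *
        (g p)^3 + 9 / (2 * b p)) - 1 / p^4 * (9/4 + 3 * g p + 1 / (2 * b p)))
      \<longlongrightarrow> - 1/3780) (at_right 0)"
    unfolding profile by real_asymp
  then show "(breve_b2 \<longlongrightarrow> - 1/3780) (at 0)"
    by (rule tendsto_radial[rotated]) (simp add: breve_b2_def coords)
  have "((\<lambda>p. 1 / p^8 * (24 - 2 / b p - (15/2 + 4 / b p) * g p - (11/2 + 3 / b p) * (g p)^2 - 2 *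
        (g p)^3) - 1 / p^6 * (11/8 + 1 / (4 * b p) + 1/2 * g p))
      \<longlongrightarrow> - 1/50400) (at_right 0)"
    unfolding profile by real_asymp
  then show "(breve_b4 \<longlongrightarrow> - 1/50400) (at 0)"
    by (rule tendsto_radial[rotated]) (simp add: breve_b4_def coords)
qed

section \<open>The second directional derivatives\<close>

theorem lemma5:
  fixes x y u v s r :: "real^3"
  shows
    "(\<forall>i\<ge>2. has_dir_deriv2 (ad_pow i) (x, y) (u, v) (s, r)
        (\<Sum>j = 1..i - 1.
            dir_deriv (ad_pow j) (x, y) (s, r) ** ad (u, v) ** ad_pow (i - j - 1) (x, y)
          + ad_pow (i - j - 1) (x, y) ** ad (u, v) ** dir_deriv (ad_pow j) (x, y) (s, r)))
   \<and> (norm x \<noteq> 0 \<longrightarrow>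
        has_dir_deriv2 (\<lambda>X. a1 (fst X)) (x, y) (u, v) (s, r)
          ((s \<bullet> u) * bar_a1 x + (x \<bullet> u) * (x \<bullet> s) * breve_a1 x)
      \<and> has_dir_deriv2 (\<lambda>X. a2 (fst X)) (x, y) (u, v) (s, r)
          ((s \<bullet> u) * bar_a2 x + (x \<bullet> u) * (x \<bullet> s) * breve_a2 x)
      \<and> has_dir_deriv2 (\<lambda>X. a3 (fst X)) (x, y) (u, v) (s, r)
          ((s \<bullet> u) * bar_a3 x + (x \<bullet> u) * (x \<bullet> s) * breve_a3 x)
      \<and> has_dir_deriv2 (\<lambda>X. a4 (fst X)) (x, y) (u, v) (s, r)
          ((s \<bullet> u) * bar_a4 x + (x \<bullet> u) * (x \<bullet> s) * breve_a4 x))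
   \<and> (norm x \<noteq> 0 \<and> beta x \<noteq> 0 \<longrightarrow>
        has_dir_deriv2 (\<lambda>X. b1 (fst X)) (x, y) (u, v) (s, r) 0
      \<and> has_dir_deriv2 (\<lambda>X. b2 (fst X)) (x, y) (u, v) (s, r)
          ((s \<bullet> u) * bar_b2 x + (x \<bullet> u) * (x \<bullet> s) * breve_b2 x)
      \<and> has_dir_deriv2 (\<lambda>X. b3 (fst X)) (x, y) (u, v) (s, r) 0
      \<and> has_dir_deriv2 (\<lambda>X. b4 (fst X)) (x, y) (u, v) (s, r)
          ((s \<bullet> u) * bar_b4 x + (x \<bullet> u) * (x \<bullet> s) * breve_b4 x))
   \<and> (breve_a1 \<longlongrightarrow> - 1/90) (at 0)
   \<and> (breve_a2 \<longlongrightarrow> - 1/630) (at 0)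
   \<and> (breve_a3 \<longlongrightarrow> 1/1680) (at 0)
   \<and> (breve_a4 \<longlongrightarrow> 1/15120) (at 0)
   \<and> (breve_b2 \<longlongrightarrow> - 1/3780) (at 0)
   \<and> (breve_b4 \<longlongrightarrow> - 1/50400) (at 0)"
proof (intro conjI impI breve_tendsto)
  show "\<forall>i\<ge>2. has_dir_deriv2 (ad_pow i) (x, y) (u, v) (s, r)
        (\<Sum>j = 1..i - 1.
            dir_deriv (ad_pow j) (x, y) (s, r) ** ad (u, v) ** ad_pow (i - j - 1) (x, y)
          + ad_pow (i - j - 1) (x, y) ** ad (u, v) ** dir_deriv (ad_pow j) (x, y) (s, r))"
    using has_dir_deriv2_ad_pow by simp
next
  have radial: "has_dir_deriv2 (\<lambda>X. F (fst X)) (x, y) (u, v) (s, r)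
      ((s \<bullet> u) * g x + (x \<bullet> u) * (x \<bullet> s) * h x)"
    if "open D" "x \<in> D"
      and "\<And>z. z \<in> D \<Longrightarrow> (F has_derivative (\<lambda>w. g z * (z \<bullet> w))) (at z)"
      and "\<And>z. z \<in> D \<Longrightarrow> (g has_derivative (\<lambda>w. h z * (z \<bullet> w))) (at z)"
    for D and F g h :: "real^3 \<Rightarrow> real"
    using has_dir_deriv2_radial[where X = "(x, y)" and U = "(u, v)" and S = "(s, r)"
        and F = F and g = g and h = "h x"] that
    by (auto simp: eventually_nhds)
  {
    assume "norm x \<noteq> 0"
    then have x: "open (- {0 :: real^3})" "x \<in> - {0}"
      by auto
    show "has_dir_deriv2 (\<lambda>X. a1 (fst X)) (x, y) (u, v) (s, r)
          ((s \<bullet> u) * bar_a1 x + (x \<bullet> u) * (x \<bullet> s) * breve_a1 x)"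
      by (rule radial[OF x]) (simp_all add: a1_grad bar_a1_grad)
    show "has_dir_deriv2 (\<lambda>X. a2 (fst X)) (x, y) (u, v) (s, r)
          ((s \<bullet> u) * bar_a2 x + (x \<bullet> u) * (x \<bullet> s) * breve_a2 x)"
      by (rule radial[OF x]) (simp_all add: a2_grad bar_a2_grad)
    show "has_dir_deriv2 (\<lambda>X. a3 (fst X)) (x, y) (u, v) (s, r)
          ((s \<bullet> u) * bar_a3 x + (x \<bullet> u) * (x \<bullet> s) * breve_a3 x)"
      by (rule radial[OF x]) (simp_all add: a3_grad bar_a3_grad)
    show "has_dir_deriv2 (\<lambda>X. a4 (fst X)) (x, y) (u, v) (s, r)
          ((s \<bullet> u) * bar_a4 x + (x \<bullet> u) * (x \<bullet> s) * breve_a4 x)"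
      by (rule radial[OF x]) (simp_all add: a4_grad bar_a4_grad)
  }
  {
    assume "norm x \<noteq> 0 \<and> beta x \<noteq> 0"
    then have x: "x \<in> b_domain"
      by (simp add: b_domain_def)
    show "has_dir_deriv2 (\<lambda>X. b2 (fst X)) (x, y) (u, v) (s, r)
          ((s \<bullet> u) * bar_b2 x + (x \<bullet> u) * (x \<bullet> s) * breve_b2 x)"
      by (rule radial[OF open_b_domain x b2_grad bar_b2_grad])
    show "has_dir_deriv2 (\<lambda>X. b4 (fst X)) (x, y) (u, v) (s, r)
          ((s \<bullet> u) * bar_b4 x + (x \<bullet> u) * (x \<bullet> s) * breve_b4 x)"
      by (rule radial[OF open_b_domain x b4_grad bar_b4_grad])
  }
  show "has_dir_deriv2 (\<lambda>X. b1 (fst X)) (x, y) (u, v) (s, r) 0"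
    and "has_dir_deriv2 (\<lambda>X. b3 (fst X)) (x, y) (u, v) (s, r) 0"
    by (simp_all only: b1_def b3_def has_dir_deriv2_const)
qed

end
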